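(* Let $q>1$ be a square-free integer, let $P=\phi(q)/q$, and let $0=s_1<s_2<s_3<\cdots$ be the squares modulo $q$ in increasing order. Then $$\frac1q\sum_{s_i<q}(s_{i+1}-s_i)^2\ll 2^{\omega(q)}\,P\,(\log q)\prod_{p\mid q}\Big(1+\frac1{\sqrt p}\Big),$$ with an absolute implied constant.
   Context: For square-free $q$, an integer $s$ is called a square modulo $q$ if $s$ is a square modulo $p$ for every prime $p$ dividing $q$; $0$ counts as a square. The sequence $(s_i)$ enumerates all non-negative integers that are squares modulo $q$ (so for the largest $s_i<q$ the next term is $s_{i+1}=q$). $\phi$ is Euler's totient function, $\omega(q)$ is the number of distinct prime divisors of $q$, and the product runs over primes. $f\ll g$ means $|f|\le Cg$ for some constant $C>0$. *)

theory Defs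
  imports
    Complex_Main
    "HOL-Library.Infinite_Set"
    "HOL-Number_Theory.Number_Theory"
    "HOL-Computational_Algebra.Computational_Algebra"
begin

(* 0 counts as a square: QuadRes p a only asks for some y with y^2 = a (mod p). *)
definition squares_mod :: "nat \<Rightarrow> nat set" where
  "squares_mod q = {s. \<forall>p. prime p \<and> p dvd q \<longrightarrow> QuadRes (int p) (int s)}"

(* Increasing enumeration of all squares modulo q, not only those below q.
   It starts at index 0, so s_1 = 0 in one-based notation is square_seq q 0. *)
definition square_seq :: "nat \<Rightarrow> nat \<Rightarrow> nat" where
  "square_seq q i = enumerate (squares_mod q) i"

lemma infinite_squares_mod: "infinite (squares_mod q)"
proof -
  have "range (\<lambda>n::nat. n ^ 2) \<subseteq> squares_mod q"
    by (auto simp: squares_mod_def QuadRes_def) (meson cong_refl)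
  moreover have "inj (\<lambda>n::nat. n ^ 2)"
    by (simp add: inj_def)
  ultimately show ?thesis
    using finite_subset range_inj_infinite by blast
qed

lemma strict_mono_square_seq: "strict_mono (square_seq q)"
  by (simp add: strict_mono_def square_seq_def infinite_squares_mod)

lemma range_square_seq: "range (square_seq q) = squares_mod q"
  using range_enumerate[OF infinite_squares_mod] by (simp add: square_seq_def)

lemma square_seq_0: "square_seq q 0 = 0"
proof -
  have "0 \<in> squares_mod q"
    by (auto simp: squares_mod_def QuadRes_def intro!: exI[of _ "0::int"])
  then show ?thesis
    by (simp add: square_seq_def enumerate_0 Least_eq_0)
qed

lemma finite_square_seq_less: "finite {i. square_seq q i < n}"
proof (rule finite_subset)
  show "{i. square_seq q i < n} \<subseteq> {..<n}"
    using strict_mono_imp_increasing[OF strict_mono_square_seq[of q]]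
    by (auto intro: le_less_trans)
qed simp

definition omega :: "nat \<Rightarrow> nat" where
  "omega q = card (prime_factors q)"

end

theory Submission
  imports Defs "HOL-Analysis.Harmonic_Numbers"
begin

text \<open>
  Let \<open>B\<close> be the set of odd primes dividing \<open>q\<close>. The weight
  \<open>\<Prod>p\<in>B. 1 + (n/p)\<close> vanishes unless \<open>n\<close> is a square modulo \<open>q\<close>, has mean value \<open>1\<close>, and
  expands into the characters \<open>\<Prod>p\<in>D. (n/p)\<close> with \<open>D \<subseteq> B\<close>. Sums of distinct characters over
  \<open>x, \<dots>, x + h - 1\<close> are orthogonal as functions of \<open>x\<close> modulo \<open>q\<close>, and each one with \<open>D \<noteq> {}\<close> has
  mean square at most \<open>h\<close>; so the weighted count in a window of length \<open>h\<close> has variance at most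
  \<open>2 ^ card B * h\<close>. By Chebyshev at most \<open>2 ^ card B * q / h\<close> of the windows contain no square, and
  summing over \<open>h \<le> q\<close> bounds the mean square gap by a multiple of \<open>2 ^ omega q * ln q\<close>.
  This suffices because \<open>(1 - 1/p) * (1 + 1/sqrt p) \<ge> 1\<close> for \<open>p \<ge> 3\<close>, so that the remaining factor
  of the claimed bound is at least \<open>1/2\<close>.
\<close>

section \<open>Sums over residues\<close>

text \<open>Since \<open>a\<close> is invertible modulo \<open>m\<close>, the map sending
  \<open>x\<close> to \<open>a * x + i\<close> permutes the residues.\<close>

lemma sum_periodic_affine:
  fixes f :: "nat \<Rightarrow> real"
  assumes m: "m > 0" and a: "coprime a m" and f: "\<And>n. f (n mod m) = f n"
  shows "(\<Sum>x<m. f (a * x + i)) = (\<Sum>x<m. f x)"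
proof -
  let ?g = "\<lambda>x. (a * x + i) mod m"
  have "inj_on ?g {..<m}"
  proof (rule inj_onI)
    fix x y assume xy: "x \<in> {..<m}" "y \<in> {..<m}" "?g x = ?g y"
    then have "[a * x = a * y] (mod m)"
      by (auto simp flip: cong_def simp: cong_add_rcancel_nat)
    then have "[x = y] (mod m)"
      using a by (simp add: cong_mult_lcancel_nat)
    then show "x = y"
      using xy by (simp add: cong_def)
  qed
  moreover have "?g ` {..<m} \<subseteq> {..<m}"
    using m by auto
  ultimately have "bij_betw ?g {..<m} {..<m}"
    by (simp add: bij_betw_def endo_inj_surj)
  then have "(\<Sum>x<m. f (?g x)) = (\<Sum>x<m. f x)"
    by (rule sum.reindex_bij_betw)
  then show ?thesis
    by (simp only: f)
qed

text \<open>By the Chinese remainder theorem a residue modulo \<open>m * n\<close> is an arbitrary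
  pair of residues, so the sum factors.\<close>

lemma sum_mult_coprime_periods:
  fixes f g :: "nat \<Rightarrow> real"
  assumes mn: "m > 0" "n > 0" "coprime m n"
    and f: "\<And>x. f (x mod m) = f x" and g: "\<And>x. g (x mod n) = g x"
  shows "(\<Sum>x<m * n. f x * g x) = (\<Sum>x<m. f x) * (\<Sum>x<n. g x)"
proof -
  let ?h = "\<lambda>x. (x mod m, x mod n)"
  have inj: "inj_on ?h {..<m * n}"
  proof (rule inj_onI)
    fix x y assume xy: "x \<in> {..<m * n}" "y \<in> {..<m * n}" "?h x = ?h y"
    then have "[x = y] (mod m * n)"
      using mn by (intro coprime_cong_mult_nat) (auto simp: cong_def)
    then show "x = y"
      using xy by (simp add: cong_def)
  qed
  moreover have "?h ` {..<m * n} = {..<m} \<times> {..<n}"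
  proof (rule card_subset_eq)
    show "?h ` {..<m * n} \<subseteq> {..<m} \<times> {..<n}"
      using mn by auto
    show "card (?h ` {..<m * n}) = card ({..<m} \<times> {..<n})"
      using inj by (simp add: card_image card_cartesian_product)
  qed simp
  ultimately have "bij_betw ?h {..<m * n} ({..<m} \<times> {..<n})"
    by (simp add: bij_betw_def)
  then have "(\<Sum>x<m * n. (\<lambda>(u, v). f u * g v) (?h x)) = (\<Sum>(u, v)\<in>{..<m} \<times> {..<n}. f u * g v)"
    by (rule sum.reindex_bij_betw)
  then show ?thesis
    by (simp add: f g sum_product sum.cartesian_product)
qed

text \<open>Distinct primes are coprime, so the two-factor case can be iterated. Sums over a full
  period thereby become local computations at each prime.\<close>

lemma sum_prod_coprime_periods:
  fixes f :: "nat \<Rightarrow> nat \<Rightarrow> real"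
  assumes "finite A" "\<And>p. p \<in> A \<Longrightarrow> prime p" "\<And>p x. p \<in> A \<Longrightarrow> f p (x mod p) = f p x"
  shows "(\<Sum>x<\<Prod>A. \<Prod>p\<in>A. f p x) = (\<Prod>p\<in>A. \<Sum>x<p. f p x)"
  using assms
proof (induction A rule: finite_induct)
  case (insert p A)
  have "coprime p (\<Prod>A)"
    using insert.hyps insert.prems(1) by (intro prod_coprime_right) (auto intro!: primes_coprime)
  moreover have "(\<Prod>r\<in>A. f r (x mod \<Prod>A)) = (\<Prod>r\<in>A. f r x)" for x
  proof (rule prod.cong)
    fix r assume r: "r \<in> A"
    then have "r dvd \<Prod>A"
      using insert.hyps by (intro dvd_prodI)
    then have "f r (x mod \<Prod>A) = f r (x mod r)"
      using insert.prems(2)[of r "x mod \<Prod>A"] r by (simp add: mod_mod_cancel)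
    then show "f r (x mod \<Prod>A) = f r x"
      using insert.prems(2) r by simp
  qed simp
  moreover have "p > 0" "\<Prod>A > 0"
    using insert.prems(1) by (simp_all add: prime_gt_0_nat prod_pos)
  ultimately have "(\<Sum>x<p * \<Prod>A. f p x * (\<Prod>r\<in>A. f r x)) = (\<Sum>x<p. f p x) * (\<Sum>x<\<Prod>A. \<Prod>r\<in>A. f r x)"
    using insert.prems(2) by (intro sum_mult_coprime_periods) auto
  then show ?case
    using insert by simp
qed simp

section \<open>The quadratic character\<close>

lemma QuadRes_cong: "[a = b] (mod p) \<Longrightarrow> QuadRes p a \<longleftrightarrow> QuadRes p b"
  by (simp add: QuadRes_def cong_def)

lemma Legendre_cong: "[a = b] (mod p) \<Longrightarrow> Legendre a p = Legendre b p"
proof -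
  assume ab: "[a = b] (mod p)"
  then have "[a = 0] (mod p) \<longleftrightarrow> [b = 0] (mod p)"
    by (simp add: cong_def)
  then show ?thesis
    by (simp add: Legendre_def QuadRes_cong[OF ab])
qed

text \<open>Euler's criterion gives the identity modulo \<open>p\<close>; the two sides differ by at
  most 2, which is less than \<open>p\<close>, so they are equal.\<close>

lemma Legendre_mult:
  assumes p: "prime p" "p > (2::nat)"
  shows "Legendre (a * b) (int p) = Legendre a (int p) * Legendre b (int p)"
proof -
  let ?L = "\<lambda>a. Legendre a (int p)"
  have "[?L (a * b) = (a * b) ^ ((p - 1) div 2)] (mod p)"
    using p by (intro euler_criterion) auto
  moreover have "[?L a * ?L b = a ^ ((p - 1) div 2) * b ^ ((p - 1) div 2)] (mod p)"
    using p by (intro cong_mult euler_criterion) auto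
  ultimately have "[?L (a * b) = ?L a * ?L b] (mod p)"
    by (metis cong_sym cong_trans power_mult_distrib)
  then have dvd: "int p dvd ?L (a * b) - ?L a * ?L b"
    by (simp add: cong_iff_dvd_diff)
  have "\<bar>?L (a * b) - ?L a * ?L b\<bar> \<le> 2"
    by (auto simp: Legendre_def)
  then have "\<bar>?L (a * b) - ?L a * ?L b\<bar> < int p"
    using p by linarith
  then show ?thesis
    using dvd zdvd_imp_le[of "int p" "\<bar>?L (a * b) - ?L a * ?L b\<bar>"] by fastforce
qed

text \<open>The Legendre symbol made real-valued, ready for variances. At \<open>p = 2\<close> it is
  the principal character, whose mean is not zero; hence the restriction to odd primes
  below.\<close>

definition chi :: "nat \<Rightarrow> nat \<Rightarrow> real" where
  "chi p n = of_int (Legendre (int n) (int p))"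

lemma chi_cong: "[a = b] (mod p) \<Longrightarrow> chi p a = chi p b"
  unfolding chi_def by (subst Legendre_cong[of "int a" "int b"]) (simp_all add: cong_int_iff)

lemma chi_mod: "chi p (n mod p) = chi p n"
  by (rule chi_cong) simp

lemma chi_mult: "prime p \<Longrightarrow> p > 2 \<Longrightarrow> chi p (a * b) = chi p a * chi p b"
  by (simp add: chi_def Legendre_mult)

lemma chi_eq_0_iff: "chi p n = 0 \<longleftrightarrow> p dvd n"
  by (auto simp: chi_def Legendre_def cong_0_iff)

lemma chi_square: "(chi p n)\<^sup>2 = (if p dvd n then 0 else 1)"
  by (auto simp: chi_def Legendre_def cong_0_iff)

lemma chi_nonresidue: "\<not> QuadRes (int p) (int n) \<Longrightarrow> chi p n = -1"
proof -
  assume nonres: "\<not> QuadRes (int p) (int n)"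
  have "QuadRes (int p) 0"
    unfolding QuadRes_def by (rule exI[of _ 0]) simp
  then have "\<not> [int n = 0] (mod int p)"
    using nonres QuadRes_cong by blast
  then show ?thesis
    using nonres by (simp add: chi_def Legendre_def)
qed

text \<open>Squaring identifies \<open>1\<close> and \<open>p - 1\<close>, so on the finite set of
  residues it is not injective and therefore misses some value.\<close>

lemma ex_nonresidue:
  assumes "prime p" "p > 2"
  obtains a where "chi p a = -1"
proof -
  let ?g = "\<lambda>y. y\<^sup>2 mod p"
  have "[(p - 1)\<^sup>2 = 1] (mod p)"
  proof -
    have "(int p - 1)\<^sup>2 - 1 = int p * (int p - 2)"
      by (simp add: power2_eq_square algebra_simps)
    then have "[(int p - 1)\<^sup>2 = 1] (mod int p)"
      by (simp add: cong_iff_dvd_diff)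
    then show ?thesis
      using assms by (simp flip: cong_int_iff add: of_nat_diff)
  qed
  then have "?g (p - 1) = ?g 1"
    by (simp add: cong_def)
  then have "\<not> inj_on ?g {..<p}"
    using assms inj_onD[of ?g "{..<p}" "p - 1" 1] by force
  then have "?g ` {..<p} \<noteq> {..<p}"
    using eq_card_imp_inj_on[of "{..<p}" ?g] by auto
  moreover have "?g ` {..<p} \<subseteq> {..<p}"
    using assms by auto
  ultimately obtain a where a: "a < p" "a \<notin> ?g ` {..<p}"
    by auto
  have "\<not> QuadRes (int p) (int a)"
  proof
    assume "QuadRes (int p) (int a)"
    then obtain y where y: "[y\<^sup>2 = int a] (mod int p)"
      by (auto simp: QuadRes_def)
    define z where "z = nat (y mod int p)"
    have z: "int z = y mod int p" "z < p"
      using assms by (auto simp: z_def nat_less_iff)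
    have "[int (z\<^sup>2) = int a] (mod int p)"
      using y by (simp add: z cong_def power_mod)
    then have "?g z = a"
      using a by (simp only: cong_int_iff) (simp add: cong_def)
    then show False
      using a z by auto
  qed
  then show ?thesis
    using that chi_nonresidue by blast
qed

section \<open>Complete sums and correlations of the quadratic character\<close>

text \<open>Multiplication by a nonresidue permutes the residues and flips the sign of every term,
  so the sum equals its own negative.\<close>

lemma sum_chi:
  assumes p: "prime p" "p > 2"
  shows "(\<Sum>x<p. chi p (x + i)) = 0"
proof -
  have shift: "(\<Sum>x<p. chi p (x + i)) = (\<Sum>x<p. chi p x)"
    using sum_periodic_affine[of p 1 "chi p" i] p by (simp add: chi_mod)
  obtain a where a: "chi p a = -1"
    using p by (rule ex_nonresidue)
  then have "\<not> p dvd a"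
    using chi_eq_0_iff[of p a] by auto
  then have "coprime a p"
    using p by (metis coprime_commute prime_imp_coprime)
  then have "(\<Sum>x<p. chi p x) = (\<Sum>x<p. chi p (a * x + 0))"
    using p by (intro sum_periodic_affine[symmetric]) (auto simp: chi_mod)
  also have "\<dots> = - (\<Sum>x<p. chi p x)"
    using p by (simp add: chi_mult a sum_negf)
  finally show ?thesis
    using shift by simp
qed

text \<open>Scaling by \<open>k\<close> shows that the correlation does not depend on the nonzero shift \<open>k\<close>,
  so its value follows from the vanishing of the sum over all shifts.\<close>

lemma sum_chi_shift:
  assumes p: "prime p" "p > 2"
  shows "(\<Sum>x<p. chi p x * chi p (x + k)) = (if p dvd k then real p else 0) - 1"
proof -
  define T where "T k = (\<Sum>x<p. chi p x * chi p (x + k))" for k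
  have per: "chi p (x mod p) * chi p (x mod p + k) = chi p x * chi p (x + k)" for x k
    by (metis chi_mod mod_add_left_eq)
  have T0: "T k = real p - 1" if "p dvd k" for k
  proof -
    have "chi p (x + k) = chi p x" for x
      using that by (intro chi_cong) (auto simp: cong_def elim!: dvdE)
    then have "T k = (\<Sum>x<p. (chi p x)\<^sup>2)"
      by (simp add: T_def power2_eq_square)
    also have "\<dots> = (\<Sum>x<p. 1 - (if x = 0 then 1 else 0))"
      by (intro sum.cong) (auto simp: chi_square dest: dvd_imp_le)
    finally show ?thesis
      using p by (simp add: sum_subtractf)
  qed
  have T1: "T k = T 1" if "\<not> p dvd k" for k
  proof -
    have "coprime k p"
      using p that by (metis coprime_commute prime_imp_coprime)
    then have "T k = (\<Sum>x<p. chi p (k * x + 0) * chi p (k * x + 0 + k))"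
      unfolding T_def using p per
      by (intro sum_periodic_affine[where f = "\<lambda>x. chi p x * chi p (x + k)", symmetric]) auto
    also have "\<dots> = (\<Sum>x<p. (chi p k)\<^sup>2 * (chi p x * chi p (x + 1)))"
    proof (rule sum.cong)
      fix x
      have "k * x + 0 + k = k * (x + 1)"
        by simp
      then show "chi p (k * x + 0) * chi p (k * x + 0 + k) = (chi p k)\<^sup>2 * (chi p x * chi p (x + 1))"
        using p by (simp only: chi_mult add_0_right) (simp add: power2_eq_square)
    qed simp
    finally show ?thesis
      using that by (simp add: chi_square T_def)
  qed
  have "(\<Sum>k<p. T k) = (\<Sum>x<p. chi p x * (\<Sum>k<p. chi p (k + x)))"
    unfolding T_def by (subst sum.swap) (simp add: sum_distrib_left add.commute)
  then have "(\<Sum>k<p. T k) = 0"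
    using p by (simp add: sum_chi)
  moreover have "(\<Sum>k<p. T k) = T 0 + (\<Sum>k\<in>{..<p} - {0}. T k)"
    using p by (intro sum.remove) auto
  moreover have "(\<Sum>k\<in>{..<p} - {0}. T k) = (\<Sum>k\<in>{..<p} - {0}. T 1)"
    by (intro sum.cong T1) (auto dest: dvd_imp_le)
  ultimately have "(real p - 1) * (1 + T 1) = 0"
    using p T0[of 0] by (simp add: algebra_simps of_nat_diff)
  then have "T 1 = -1"
    using p by auto
  then show ?thesis
    using T0 T1 by (simp add: T_def)
qed

lemma sum_chi_chi:
  assumes p: "prime p" "p > 2"
  shows "(\<Sum>x<p. chi p (x + i) * chi p (x + j)) = (if [i = j] (mod p) then real p else 0) - 1"
proof -
  \<comment> \<open>\<open>k\<close> represents \<open>j - i\<close> modulo \<open>p\<close>: the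
    term \<open>(p - 1) * i\<close> plays the part of \<open>- i\<close> without subtraction on the
    naturals.\<close>
  define k where "k = j + (p - 1) * i"
  have eq: "i + k = j + p * i"
    using p by (cases p) (auto simp: k_def)
  have "chi p (x + j) = chi p (x + i + k)" for x
  proof (rule chi_cong)
    have "x + i + k = x + j + p * i"
      using eq by linarith
    then show "[x + j = x + i + k] (mod p)"
      by (simp only: cong_def mod_mult_self2)
  qed
  then have "(\<Sum>x<p. chi p (x + i) * chi p (x + j)) = (\<Sum>x<p. chi p (1 * x + i) * chi p (1 * x + i + k))"
    by simp
  also have "\<dots> = (\<Sum>x<p. chi p x * chi p (x + k))"
  proof (rule sum_periodic_affine[where f = "\<lambda>x. chi p x * chi p (x + k)"])
    show "chi p (x mod p) * chi p (x mod p + k) = chi p x * chi p (x + k)" for x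
      by (metis chi_mod mod_add_left_eq)
  qed (use p in auto)
  also have "\<dots> = (if p dvd k then real p else 0) - 1"
    by (rule sum_chi_shift[OF p])
  also have "p dvd k \<longleftrightarrow> [i = j] (mod p)"
  proof -
    have "[i = j] (mod p) \<longleftrightarrow> [i + 0 = i + k] (mod p)"
      by (simp add: eq cong_def)
    also have "\<dots> \<longleftrightarrow> [0 = k] (mod p)"
      by (rule cong_add_lcancel_nat)
    finally show ?thesis
      by (auto simp: cong_def mod_eq_0_iff_dvd)
  qed
  finally show ?thesis .
qed

section \<open>Second moment in short intervals\<close>

text \<open>For a finite set \<open>D\<close> of odd primes this is the Jacobi symbol of
  \<open>n\<close> over \<open>\<Prod>D\<close>.\<close>

definition chi_prod :: "nat set \<Rightarrow> nat \<Rightarrow> real" where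
  "chi_prod D n = (\<Prod>p\<in>D. chi p n)"

definition chi_sum :: "nat \<Rightarrow> nat set \<Rightarrow> nat \<Rightarrow> real" where
  "chi_sum h D x = (\<Sum>i<h. chi_prod D (x + i))"

text \<open>For a finite set \<open>D\<close> of odd primes this is the sum of
  \<open>(chi_sum h D x)\<^sup>2\<close> over \<open>x\<close> modulo \<open>\<Prod>D\<close>, in
  closed form. The inner product is the Ramanujan sum of modulus \<open>\<Prod>D\<close> at
  \<open>i - j\<close>.\<close>

definition chi_corr :: "nat \<Rightarrow> nat set \<Rightarrow> real" where
  "chi_corr h D = (\<Sum>i<h. \<Sum>j<h. \<Prod>p\<in>D. (if [i = j] (mod p) then real p else 0) - 1)"

text \<open>The sum splits over the primes of \<open>A\<close>. A prime in exactly one of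
  \<open>D\<close> and \<open>E\<close> contributes a complete character sum, hence 0; a prime in
  both contributes a correlation, and a prime in neither contributes \<open>p\<close>.\<close>

lemma sum_chi_prod:
  assumes A: "finite A" "\<And>p. p \<in> A \<Longrightarrow> prime p" and DE: "D \<subseteq> A - {2}" "E \<subseteq> A - {2}"
  shows "(\<Sum>x<\<Prod>A. chi_prod D (x + i) * chi_prod E (x + j)) =
    (if D = E then (\<Prod>p\<in>D. (if [i = j] (mod p) then real p else 0) - 1) * real (\<Prod>(A - D)) else 0)"
proof -
  \<comment> \<open>Padding with 1 puts both character products over the common index set
    \<open>A\<close>.\<close>
  define f where "f p x = (if p \<in> D then chi p (x + i) else 1) * (if p \<in> E then chi p (x + j) else 1)" for p x
  have odd: "prime p" "p > 2" if "p \<in> D \<union> E" for p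
    using that A DE prime_ge_2_nat[of p] by (auto simp: le_less)
  have per: "chi p (x mod p + k) = chi p (x + k)" for p x k
    by (metis chi_mod mod_add_left_eq)
  have restrict: "(\<Prod>p\<in>A. if p \<in> F then g p else 1) = (\<Prod>p\<in>F. g p)" if "F \<subseteq> A - {2}" for F and g :: "nat \<Rightarrow> real"
    using that A(1) by (subst prod.inter_restrict[symmetric]) (auto intro!: arg_cong[where f = "prod g"])
  have "(\<Sum>x<\<Prod>A. chi_prod D (x + i) * chi_prod E (x + j)) = (\<Sum>x<\<Prod>A. \<Prod>p\<in>A. f p x)"
    unfolding f_def prod.distrib using DE by (simp add: restrict chi_prod_def)
  also have "\<dots> = (\<Prod>p\<in>A. \<Sum>x<p. f p x)"
    using A by (intro sum_prod_coprime_periods) (auto simp: f_def per)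
  finally have eq: "(\<Sum>x<\<Prod>A. chi_prod D (x + i) * chi_prod E (x + j)) = (\<Prod>p\<in>A. \<Sum>x<p. f p x)" .
  show ?thesis
  proof (cases "D = E")
    case True
    have "(\<Prod>p\<in>A. \<Sum>x<p. f p x) = (\<Prod>p\<in>A - D. \<Sum>x<p. f p x) * (\<Prod>p\<in>D. \<Sum>x<p. f p x)"
      using DE A by (intro prod.subset_diff) auto
    moreover have "(\<Prod>p\<in>A - D. \<Sum>x<p. f p x) = real (\<Prod>(A - D))"
      using True by (simp add: f_def)
    moreover have "(\<Prod>p\<in>D. \<Sum>x<p. f p x) = (\<Prod>p\<in>D. (if [i = j] (mod p) then real p else 0) - 1)"
      using True odd by (intro prod.cong) (simp_all add: f_def sum_chi_chi)
    ultimately show ?thesis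
      using eq True by (simp add: mult.commute)
  next
    case False
    then obtain p where p: "p \<in> (D - E) \<union> (E - D)"
      by blast
    then have "(\<Sum>x<p. f p x) = 0"
      using odd by (auto simp: f_def sum_chi)
    moreover have "p \<in> A"
      using p DE by auto
    ultimately show ?thesis
      using eq False A(1) by (auto intro: prod_zero)
  qed
qed

lemma sum_chi_sum:
  assumes A: "finite A" "\<And>p. p \<in> A \<Longrightarrow> prime p" and DE: "D \<subseteq> A - {2}" "E \<subseteq> A - {2}"
  shows "(\<Sum>x<\<Prod>A. chi_sum h D x * chi_sum h E x) = (if D = E then chi_corr h D * real (\<Prod>(A - D)) else 0)"
proof -
  have "(\<Sum>x<\<Prod>A. chi_sum h D x * chi_sum h E x) =
      (\<Sum>x<\<Prod>A. \<Sum>i<h. \<Sum>j<h. chi_prod D (x + i) * chi_prod E (x + j))"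
    by (simp add: chi_sum_def sum_product)
  also have "\<dots> = (\<Sum>i<h. \<Sum>x<\<Prod>A. \<Sum>j<h. chi_prod D (x + i) * chi_prod E (x + j))"
    by (rule sum.swap)
  also have "\<dots> = (\<Sum>i<h. \<Sum>j<h. \<Sum>x<\<Prod>A. chi_prod D (x + i) * chi_prod E (x + j))"
    by (intro sum.cong refl sum.swap)
  finally show ?thesis
    by (simp add: sum_chi_prod[OF assms] chi_corr_def sum_distrib_right)
qed

section \<open>Upper bounds for correlations and variance\<close>

lemma card_cong_less_le:
  assumes "d > 0"
  shows "card {j. j < h \<and> [i = j] (mod d)} \<le> h div d + 1"
proof -
  have "inj_on (\<lambda>j. j div d) {j. j < h \<and> [i = j] (mod d)}"
    by (rule inj_onI) (metis (mono_tags, lifting) cong_def div_mult_mod_eq mem_Collect_eq)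
  then have "card {j. j < h \<and> [i = j] (mod d)} \<le> card {..h div d}"
    by (rule card_inj_on_le) (auto intro: div_le_mono)
  then show ?thesis
    by simp
qed

text \<open>Summing over all subsets expands a product of factors \<open>(a - 1) + 1\<close>, so the
  -1 terms disappear. What remains is \<open>\<Prod>D\<close> times the indicator of
  \<open>i\<close> and \<open>j\<close> being congruent modulo \<open>\<Prod>D\<close>, and each
  \<open>i\<close> has at most \<open>h div \<Prod>D + 1\<close> such partners
  \<open>j\<close>.\<close>

lemma sum_chi_corr_subsets_le:
  assumes D: "finite D" "\<And>p. p \<in> D \<Longrightarrow> prime p"
  shows "(\<Sum>E\<in>Pow D. chi_corr h E) \<le> (real h)\<^sup>2 + real h * real (\<Prod>D)"
proof -
  let ?d = "\<Prod>D"
  have d: "?d > 0"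
    using D by (intro prod_pos) (simp add: prime_gt_0_nat)
  have "(\<Sum>E\<in>Pow D. chi_corr h E) =
      (\<Sum>i<h. \<Sum>j<h. \<Sum>E\<in>Pow D. \<Prod>p\<in>E. (if [i = j] (mod p) then real p else 0) - 1)"
    unfolding chi_corr_def by (subst sum.swap, intro sum.cong refl, subst sum.swap) simp
  also have "\<dots> = (\<Sum>i<h. \<Sum>j<h. \<Prod>p\<in>D. if [i = j] (mod p) then real p else 0)"
  proof (intro sum.cong refl)
    fix i j
    show "(\<Sum>E\<in>Pow D. \<Prod>p\<in>E. (if [i = j] (mod p) then real p else 0) - 1) =
        (\<Prod>p\<in>D. if [i = j] (mod p) then real p else 0)"
      using prod_add[OF D(1), of "\<lambda>p. (if [i = j] (mod p) then real p else 0) - 1" "\<lambda>_. 1"] by simp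
  qed
  also have "\<dots> \<le> (\<Sum>i<h. \<Sum>j<h. if [i = j] (mod ?d) then real ?d else 0)"
  proof (intro sum_mono)
    fix i j
    show "(\<Prod>p\<in>D. if [i = j] (mod p) then real p else 0) \<le> (if [i = j] (mod ?d) then real ?d else 0)"
    proof (cases "\<forall>p\<in>D. [i = j] (mod p)")
      case True
      then have "[i = j] (mod (\<Prod>p\<in>D. p))"
        using D by (intro coprime_cong_prod_nat) (auto intro: primes_coprime)
      then show ?thesis
        using True by simp
    next
      case False
      then have "(\<Prod>p\<in>D. if [i = j] (mod p) then real p else 0) = 0"
        using D(1) by (auto intro: prod_zero)
      then show ?thesis
        by (simp add: prod_nonneg)
    qed
  qed
  also have "\<dots> \<le> (\<Sum>i<h. real h + real ?d)"
  proof (rule sum_mono)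
    fix i
    have "(\<Sum>j<h. if [i = j] (mod ?d) then real ?d else 0) =
        real ?d * real (card {j. j < h \<and> [i = j] (mod ?d)})"
      by (simp add: sum.If_cases Int_def lessThan_def)
    also have "\<dots> \<le> real ?d * real (h div ?d + 1)"
      using card_cong_less_le[OF d] by (intro mult_left_mono of_nat_mono of_nat_0_le_iff)
    also have "\<dots> = real (?d * (h div ?d)) + real ?d"
      by (simp add: algebra_simps)
    also have "\<dots> \<le> real h + real ?d"
      by (simp only: of_nat_le_iff add_le_cancel_right times_div_less_eq_dividend)
    finally show "(\<Sum>j<h. if [i = j] (mod ?d) then real ?d else 0) \<le> real h + real ?d" .
  qed
  finally show ?thesis
    by (simp add: power2_eq_square algebra_simps)
qed

text \<open>Every \<open>chi_corr h E\<close> is nonnegative because it is proportional to a sum of squares, so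
  the empty set and \<open>D\<close> can be singled out of the sum over the subsets of \<open>D\<close>.\<close>

lemma chi_corr_le:
  assumes D: "finite D" "\<And>p. p \<in> D \<Longrightarrow> prime p" "2 \<notin> D" "D \<noteq> {}"
  shows "chi_corr h D \<le> real h * real (\<Prod>D)"
proof -
  have nonneg: "chi_corr h E \<ge> 0" if "E \<subseteq> D" for E
  proof -
    have "(\<Sum>x<\<Prod>E. chi_sum h E x * chi_sum h E x) = chi_corr h E * real (\<Prod>(E - E))"
      using D that by (subst sum_chi_sum) (auto intro: finite_subset)
    then have "chi_corr h E = (\<Sum>x<\<Prod>E. (chi_sum h E x)\<^sup>2)"
      by (simp add: power2_eq_square)
    then show ?thesis
      by (simp add: sum_nonneg)
  qed
  \<comment> \<open>The empty set contributes exactly \<open>(real h)\<^sup>2\<close>, which cancels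
    the main term of the bound over all subsets. As \<open>D\<close> is nonempty, the two sets are
    distinct.\<close>
  have "(real h)\<^sup>2 + chi_corr h D = (\<Sum>E\<in>{{}, D}. chi_corr h E)"
    using D(4) by (simp add: chi_corr_def power2_eq_square)
  also have "\<dots> \<le> (\<Sum>E\<in>Pow D. chi_corr h E)"
    using D(1) nonneg by (intro sum_mono2) auto
  also have "\<dots> \<le> (real h)\<^sup>2 + real h * real (\<Prod>D)"
    using D by (intro sum_chi_corr_subsets_le)
  finally show ?thesis
    by simp
qed

text \<open>Removing the mean \<open>h\<close> removes exactly the character of the empty set.
  Orthogonality kills the cross terms of the square, and each of the fewer than
  \<open>2 ^ card B\<close> diagonal terms is at most \<open>h * \<Prod>A\<close>.\<close>

lemma variance_le:
  assumes A: "finite A" "\<And>p. p \<in> A \<Longrightarrow> prime p" and B: "B \<subseteq> A - {2}"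
  shows "(\<Sum>x<\<Prod>A. ((\<Sum>i<h. \<Prod>p\<in>B. 1 + chi p (x + i)) - real h)\<^sup>2)
    \<le> 2 ^ card B * real h * real (\<Prod>A)"
proof -
  define N where "N = Pow B - {{}}"
  have fin: "finite B" "finite N"
    using A B by (auto simp: N_def intro: finite_subset)
  have N: "D \<subseteq> A - {2}" "finite D" if "D \<in> N" for D
    using that B fin by (auto simp: N_def intro: finite_subset)
  have split: "(\<Sum>i<h. \<Prod>p\<in>B. 1 + chi p (x + i)) - real h = (\<Sum>D\<in>N. chi_sum h D x)" for x
  proof -
    have "(\<Prod>p\<in>B. 1 + chi p n) = (\<Sum>D\<in>Pow B. chi_prod D n)" for n
      using prod_add[OF fin(1), of "\<lambda>p. chi p n" "\<lambda>_. 1"] by (simp add: chi_prod_def add.commute)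
    then have "(\<Sum>i<h. \<Prod>p\<in>B. 1 + chi p (x + i)) = (\<Sum>D\<in>Pow B. chi_sum h D x)"
      unfolding chi_sum_def by (subst sum.swap) simp
    also have "\<dots> = chi_sum h {} x + (\<Sum>D\<in>N. chi_sum h D x)"
      unfolding N_def using fin by (intro sum.remove) auto
    finally show ?thesis
      by (simp add: chi_sum_def chi_prod_def)
  qed
  have "(\<Sum>x<\<Prod>A. (\<Sum>D\<in>N. chi_sum h D x)\<^sup>2) =
      (\<Sum>x<\<Prod>A. \<Sum>D\<in>N. \<Sum>E\<in>N. chi_sum h D x * chi_sum h E x)"
    by (simp add: power2_eq_square sum_product)
  also have "\<dots> = (\<Sum>D\<in>N. \<Sum>x<\<Prod>A. \<Sum>E\<in>N. chi_sum h D x * chi_sum h E x)"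
    by (rule sum.swap)
  also have "\<dots> = (\<Sum>D\<in>N. \<Sum>E\<in>N. \<Sum>x<\<Prod>A. chi_sum h D x * chi_sum h E x)"
    by (intro sum.cong refl sum.swap)
  also have "\<dots> = (\<Sum>D\<in>N. \<Sum>E\<in>N. if D = E then chi_corr h D * real (\<Prod>(A - D)) else 0)"
    using N A by (intro sum.cong refl sum_chi_sum) auto
  also have "\<dots> = (\<Sum>D\<in>N. chi_corr h D * real (\<Prod>(A - D)))"
    using fin by simp
  also have "\<dots> \<le> (\<Sum>D\<in>N. real h * real (\<Prod>A))"
  proof (rule sum_mono)
    fix D assume D: "D \<in> N"
    have "chi_corr h D * real (\<Prod>(A - D)) \<le> real h * real (\<Prod>D) * real (\<Prod>(A - D))"
    proof (rule mult_right_mono)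
      show "chi_corr h D \<le> real h * real (\<Prod>D)"
        using D N[OF D] A by (intro chi_corr_le) (auto simp: N_def)
    qed (rule of_nat_0_le_iff)
    also have "\<dots> = real h * real (\<Prod>(A - D) * \<Prod>D)"
      by simp
    also have "\<Prod>(A - D) * \<Prod>D = \<Prod>A"
      using N[OF D] A by (intro prod.subset_diff[symmetric]) auto
    finally show "chi_corr h D * real (\<Prod>(A - D)) \<le> real h * real (\<Prod>A)" .
  qed
  also have "\<dots> = real (card N) * (real h * real (\<Prod>A))"
    by simp
  also have "\<dots> \<le> 2 ^ card B * (real h * real (\<Prod>A))"
  proof (rule mult_right_mono)
    have "card N \<le> card (Pow B)"
      using fin by (intro card_mono) (auto simp: N_def)
    then have "card N \<le> 2 ^ card B"
      using fin by (simp add: card_Pow)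
    then show "real (card N) \<le> 2 ^ card B"
      by (metis of_nat_le_iff of_nat_numeral of_nat_power)
  qed (simp add: prod_nonneg)
  finally show ?thesis
    by (simp add: split mult.assoc)
qed

section \<open>Gaps between squares\<close>

lemma prod_chi_nonsquare:
  assumes q: "q > 0" and n: "n \<notin> squares_mod q"
  shows "(\<Prod>p\<in>prime_factors q - {2}. 1 + chi p n) = 0"
proof -
  obtain p where p: "prime p" "p dvd q" "\<not> QuadRes (int p) (int n)"
    using n by (auto simp: squares_mod_def)
  \<comment> \<open>Every integer is a square modulo 2, so the prime that obstructs \<open>n\<close>
    is odd and its factor \<open>1 + chi p n\<close> is present in the product.\<close>
  have "QuadRes 2 (int n)"
    unfolding QuadRes_def by (rule exI[of _ "int n"]) (simp add: cong_def power2_eq_square mod_2_eq_odd)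
  then have "p \<noteq> 2"
    using p by auto
  then have "p \<in> prime_factors q - {2}"
    using p q by (auto simp: in_prime_factors_iff)
  then show ?thesis
    using p by (intro prod_zero) (auto intro!: bexI[of _ p] simp: chi_nonresidue)
qed

definition empty_starts :: "nat \<Rightarrow> nat \<Rightarrow> nat set" where
  "empty_starts q h = {x. x < q \<and> {x..<x + h} \<inter> squares_mod q = {}}"

text \<open>Chebyshev's inequality: on a window without squares the weighted count is 0, so it
  deviates from its mean by \<open>h\<close> and adds \<open>(real h)\<^sup>2\<close> to the
  variance sum.\<close>

lemma card_empty_starts_le:
  assumes q: "squarefree q" "q > 0" and h: "h > 0"
  shows "real (card (empty_starts q h)) \<le> 2 ^ omega q * real q / real h"
proof -
  let ?A = "prime_factors q" and ?B = "prime_factors q - {2}"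
  let ?R = "\<lambda>x. (\<Sum>i<h. \<Prod>p\<in>?B. 1 + chi p (x + i))"
  have A: "\<Prod>?A = q"
  proof -
    have "multiplicity p q = 1" if "p \<in> ?A" for p
      using q that squarefree_factorial_semiring'[of q] by auto
    then have "\<Prod>?A = (\<Prod>p\<in>?A. p ^ multiplicity p q)"
      by (intro prod.cong) simp_all
    also have "\<dots> = q"
      using q by (simp add: prime_factorization_nat[symmetric])
    finally show ?thesis .
  qed
  have "real (card (empty_starts q h)) * (real h)\<^sup>2 = (\<Sum>x\<in>empty_starts q h. (?R x - real h)\<^sup>2)"
  proof -
    have "?R x = 0" if "x \<in> empty_starts q h" for x
    proof (intro sum.neutral ballI prod_chi_nonsquare q(2))
      fix i assume "i \<in> {..<h}"
      then show "x + i \<notin> squares_mod q"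
        using that by (auto simp: empty_starts_def disjoint_iff)
    qed
    then show ?thesis
      by simp
  qed
  also have "\<dots> \<le> (\<Sum>x<q. (?R x - real h)\<^sup>2)"
    by (intro sum_mono2) (auto simp: empty_starts_def)
  also have "\<dots> \<le> 2 ^ card ?B * real h * real q"
    using variance_le[of ?A ?B h] A by auto
  also have "\<dots> \<le> 2 ^ omega q * real h * real q"
    unfolding omega_def by (intro mult_right_mono power_increasing card_mono) auto
  finally have "(real (card (empty_starts q h)) * real h) * real h \<le> (2 ^ omega q * real q) * real h"
    by (simp add: power2_eq_square mult_ac)
  then show ?thesis
    using h by (simp add: field_simps)
qed

section \<open>From empty windows to squared gaps\<close>

text \<open>For \<open>q > 0\<close> this is the distance from \<open>x\<close> to the first square
  not below it; the cap \<open>q\<close> loses nothing because multiples of \<open>q\<close> are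
  squares. Counting lengths allows the sums over \<open>x\<close> and \<open>h\<close> to be
  exchanged.\<close>

definition empty_lengths :: "nat \<Rightarrow> nat \<Rightarrow> nat" where
  "empty_lengths q x = card {h. 1 \<le> h \<and> h \<le> q \<and> {x..<x + h} \<inter> squares_mod q = {}}"

lemma sum_empty_lengths: "(\<Sum>x<q. empty_lengths q x) = (\<Sum>h=1..q. card (empty_starts q h))"
proof -
  let ?P = "\<lambda>x h. {x..<x + h} \<inter> squares_mod q = {}"
  have "(\<Sum>x<q. empty_lengths q x) = (\<Sum>x<q. \<Sum>h=1..q. if ?P x h then 1 else 0)"
    by (intro sum.cong refl) (simp add: empty_lengths_def sum.If_cases Int_def conj_assoc)
  also have "\<dots> = (\<Sum>h=1..q. \<Sum>x<q. if ?P x h then 1 else 0)"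
    by (rule sum.swap)
  also have "\<dots> = (\<Sum>h=1..q. card (empty_starts q h))"
    by (intro sum.cong refl) (simp add: empty_starts_def sum.If_cases Int_def)
  finally show ?thesis .
qed

lemma not_square_in_gap:
  assumes "square_seq q i < x" "x < square_seq q (Suc i)"
  shows "x \<notin> squares_mod q"
proof
  assume "x \<in> squares_mod q"
  then obtain k where "x = square_seq q k"
    using range_square_seq[of q] by auto
  then show False
    using assms strict_mono_less[OF strict_mono_square_seq[of q]] by auto
qed

lemma gap_le_empty_lengths:
  assumes "square_seq q i < x" "x < square_seq q (Suc i)" "square_seq q (Suc i) \<le> q"
  shows "square_seq q (Suc i) - x \<le> empty_lengths q x"
proof -
  have "{1..square_seq q (Suc i) - x} \<subseteq> {h. 1 \<le> h \<and> h \<le> q \<and> {x..<x + h} \<inter> squares_mod q = {}}"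
    using assms not_square_in_gap[of q i] by (auto simp: disjoint_iff)
  then have "card {1..square_seq q (Suc i) - x} \<le> empty_lengths q x"
    unfolding empty_lengths_def by (intro card_mono) (auto intro: finite_subset[of _ "{..q}"])
  then show ?thesis
    by simp
qed

text \<open>A gap \<open>g\<close> satisfies \<open>g\<^sup>2 = g + 2 * (1 + ... + (g - 1))\<close>,
  and the bracket sums the distances from the interior points of the gap to its right end. The
  linear terms telescope because the sequence starts at 0.\<close>

lemma sum_gap_squares_upto_le:
  assumes "square_seq q n \<le> q"
  shows "(\<Sum>i<n. (square_seq q (Suc i) - square_seq q i)\<^sup>2) \<le>
    square_seq q n + 2 * (\<Sum>x<square_seq q n. empty_lengths q x)"
  using assms
proof (induction n)
  case (Suc n)
  let ?a = "square_seq q n" and ?b = "square_seq q (Suc n)"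
  have ab: "?a < ?b"
    using strict_mono_square_seq by (simp add: strict_mono_def)
  have "(?b - ?a)\<^sup>2 \<le> (?b - ?a) + 2 * (\<Sum>x\<in>{?a<..<?b}. ?b - x)"
  proof -
    have "(\<Sum>x\<in>{?a<..<?b}. ?b - x) = (\<Sum>y\<in>{1..<?b - ?a}. y)"
      by (rule sum.reindex_bij_witness[of _ "\<lambda>y. ?b - y" "\<lambda>x. ?b - x"]) auto
    also have "2 * \<dots> = (?b - ?a) * (?b - ?a - 1)"
    proof -
      have "2 * (\<Sum>y\<in>{1..<m}. y) = m * (m - 1)" for m :: nat
        by (induction m) (auto simp: algebra_simps)
      then show ?thesis .
    qed
    finally have "2 * (\<Sum>x\<in>{?a<..<?b}. ?b - x) = (?b - ?a) * (?b - ?a - 1)" .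
    moreover have "m\<^sup>2 = m + m * (m - 1)" for m :: nat
      by (cases m) (auto simp: power2_eq_square)
    ultimately show ?thesis
      by (metis order_refl)
  qed
  also have "(\<Sum>x\<in>{?a<..<?b}. ?b - x) \<le> (\<Sum>x\<in>{?a<..<?b}. empty_lengths q x)"
    using Suc.prems by (intro sum_mono gap_le_empty_lengths) auto
  \<comment> \<open>Including the left end gives half-open ranges that concatenate from one gap to
    the next.\<close>
  also have "\<dots> \<le> (\<Sum>x\<in>{?a..<?b}. empty_lengths q x)"
    by (intro sum_mono2) auto
  finally have step: "(?b - ?a)\<^sup>2 \<le> (?b - ?a) + 2 * (\<Sum>x\<in>{?a..<?b}. empty_lengths q x)"
    by simp
  have "(\<Sum>x<?a. empty_lengths q x) + (\<Sum>x\<in>{?a..<?b}. empty_lengths q x) = (\<Sum>x<?b. empty_lengths q x)"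
    using ab by (simp add: lessThan_atLeast0 sum.atLeastLessThan_concat)
  moreover have "?a \<le> q"
    using ab Suc.prems by simp
  ultimately show ?case
    using Suc.IH step ab by simp
qed (simp add: square_seq_0)

lemma sum_gap_squares_le:
  "(\<Sum>i | square_seq q i < q. (square_seq q (Suc i) - square_seq q i)\<^sup>2) \<le>
    q + 2 * (\<Sum>h=1..q. card (empty_starts q h))"
proof -
  \<comment> \<open>As a square itself, \<open>q\<close> is a term of the sequence, so the last gap
    counted ends exactly at \<open>q\<close>.\<close>
  have "q \<in> squares_mod q"
    by (auto simp: squares_mod_def QuadRes_def cong_def intro!: exI[of _ 0])
  then obtain n where n: "square_seq q n = q"
    using range_square_seq[of q] by (metis imageE)
  have "{i. square_seq q i < q} = {..<n}"
    using strict_mono_less[OF strict_mono_square_seq[of q], of _ n] by (simp add: n lessThan_def)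
  then show ?thesis
    using sum_gap_squares_upto_le[of q n] n by (simp add: sum_empty_lengths)
qed

text \<open>The harmonic number minus the logarithm is decreasing and equals 1 at its first term,
  which has index 0; \<open>q\<close> therefore sits at index \<open>q - 1\<close>.\<close>

lemma sum_inverse_le_ln: "q > 0 \<Longrightarrow> (\<Sum>h=1..q. 1 / real h) \<le> 1 + ln (real q)"
  using decseqD[OF decseq_harm_diff_ln, of 0 "q - 1"] by (simp add: harm_def inverse_eq_divide)

lemma mean_gap_squares_le:
  assumes q: "squarefree q" "q > 0"
  shows "1 / real q * (\<Sum>i | square_seq q i < q. (real (square_seq q (Suc i)) - real (square_seq q i))\<^sup>2)
    \<le> 2 ^ omega q * (3 + 2 * ln (real q))"
proof -
  have "(\<Sum>i | square_seq q i < q. (real (square_seq q (Suc i)) - real (square_seq q i))\<^sup>2) =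
      real (\<Sum>i | square_seq q i < q. (square_seq q (Suc i) - square_seq q i)\<^sup>2)"
    using strict_mono_square_seq[of q]
    by (simp add: of_nat_diff strict_mono_less_eq)
  also have "\<dots> \<le> real (q + 2 * (\<Sum>h=1..q. card (empty_starts q h)))"
    using sum_gap_squares_le[of q] by (simp only: of_nat_le_iff)
  also have "\<dots> = real q + 2 * (\<Sum>h=1..q. real (card (empty_starts q h)))"
    by simp
  also have "(\<Sum>h=1..q. real (card (empty_starts q h))) \<le> (\<Sum>h=1..q. 2 ^ omega q * real q / real h)"
    using q by (intro sum_mono card_empty_starts_le) auto
  also have "\<dots> = 2 ^ omega q * real q * (\<Sum>h=1..q. 1 / real h)"
    by (simp add: sum_distrib_left)
  also have "\<dots> \<le> 2 ^ omega q * real q * (1 + ln (real q))"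
    using q by (intro mult_left_mono sum_inverse_le_ln) auto
  finally have "(\<Sum>i | square_seq q i < q. (real (square_seq q (Suc i)) - real (square_seq q i))\<^sup>2)
      \<le> real q * (1 + 2 * 2 ^ omega q * (1 + ln (real q)))"
    by (simp add: algebra_simps)
  \<comment> \<open>The lone 1 is absorbed through \<open>1 \<le> 2 ^ omega q\<close>, which turns
    \<open>1 + 2\<close> into the constant 3.\<close>
  also have "\<dots> \<le> real q * (2 ^ omega q * (3 + 2 * ln (real q)))"
    using one_le_power[of "2 :: real" "omega q"] by (intro mult_left_mono) (simp_all add: algebra_simps)
  finally show ?thesis
    using q by (simp add: field_simps)
qed

section \<open>The Euler factor and the final bound\<close>

text \<open>With \<open>t = 1 / sqrt p\<close> a local factor exceeds 1 by
  \<open>t * (1 - t - t\<^sup>2)\<close>, which is nonnegative for \<open>p \<ge> 3\<close>. It is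
  negative at \<open>p = 2\<close>, where the factor is only bounded below by 1/2.\<close>

lemma totient_prod_ge:
  assumes "q > 0"
  shows "real (totient q) / real q * (\<Prod>p\<in>prime_factors q. 1 + 1 / sqrt (real p)) \<ge> 1 / 2"
proof -
  let ?f = "\<lambda>p. (1 - 1 / real p) * (1 + 1 / sqrt (real p))"
  have ge1: "?f p \<ge> 1" if "p \<ge> 3" for p
  proof -
    define t where "t = 1 / sqrt (real p)"
    have t2: "t\<^sup>2 = 1 / real p"
      by (simp add: t_def power_divide)
    \<comment> \<open>3/5 is a rational upper bound for \<open>1 / sqrt 3\<close>, small enough that
      \<open>3/5 + 1/3 < 1\<close>.\<close>
    have "t\<^sup>2 \<le> (3 / 5)\<^sup>2"
      using that by (simp add: t2 field_simps)
    then have "t \<le> 3 / 5"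
      by (rule power2_le_imp_le) simp
    moreover have "t \<ge> 0"
      by (simp add: t_def)
    moreover have "(1 - t\<^sup>2) * (1 + t) - 1 = t * (1 - t - t\<^sup>2)"
      by (simp add: power2_eq_square algebra_simps)
    moreover have "1 / real p \<le> 1 / 3"
      using that by (simp add: field_simps)
    ultimately have "(1 - t\<^sup>2) * (1 + t) - 1 \<ge> 0"
      using \<open>t\<^sup>2 \<le> (3 / 5)\<^sup>2\<close> by (simp add: power2_eq_square)
    then show ?thesis
      by (simp add: t2 t_def[symmetric])
  qed
  have "1 / 2 \<le> (\<Prod>p\<in>prime_factors q. if p = 2 then 1 / 2 else 1 :: real)"
    by (simp add: prod.delta)
  also have "\<dots> \<le> (\<Prod>p\<in>prime_factors q. ?f p)"
  proof (rule prod_mono)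
    fix p assume "p \<in> prime_factors q"
    then have "p \<ge> 2"
      by (auto intro: prime_ge_2_nat)
    then show "0 \<le> (if p = 2 then 1 / 2 else 1 :: real) \<and> (if p = 2 then 1 / 2 else 1) \<le> ?f p"
      using ge1[of p] by auto
  qed
  also have "\<dots> = real (totient q) / real q * (\<Prod>p\<in>prime_factors q. 1 + 1 / sqrt (real p))"
    using assms by (simp add: totient_formula2 prod.distrib)
  finally show ?thesis .
qed

theorem corollary1p1:
  shows "\<exists>C::real. C > 0 \<and> (\<forall>q::nat. q > 1 \<longrightarrow> squarefree q \<longrightarrow>
    (let P = real (totient q) / real q in
      \<bar>1 / real q * (\<Sum>i | square_seq q i < q.
          (real (square_seq q (Suc i)) - real (square_seq q i)) ^ 2)\<bar>
      \<le> C * (2 ^ omega q * P * ln (real q)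
          * (\<Prod>p\<in>prime_factors q. 1 + 1 / sqrt (real p)))))"
proof (intro exI[of _ 16] conjI allI impI)
  fix q :: nat assume q: "q > 1" "squarefree q"
  define M where "M = 1 / real q * (\<Sum>i | square_seq q i < q.
    (real (square_seq q (Suc i)) - real (square_seq q i)) ^ 2)"
  define K where "K = real (totient q) / real q * (\<Prod>p\<in>prime_factors q. 1 + 1 / sqrt (real p))"
  have "1 / 2 \<le> ln (2 :: real)"
    using ln2_ge_two_thirds by linarith
  also have "\<dots> \<le> ln (real q)"
    using q by simp
  finally have ln: "1 / 2 \<le> ln (real q)" .
  have "\<bar>M\<bar> = M"
    by (simp add: M_def sum_nonneg)
  also have "\<dots> \<le> 2 ^ omega q * (3 + 2 * ln (real q))"
    unfolding M_def using q by (intro mean_gap_squares_le) auto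
  \<comment> \<open>From \<open>ln q \<ge> 1/2\<close> follows
    \<open>3 + 2 * ln q \<le> 8 * ln q\<close>; the constant 16 is twice 8, to pay for the lower
    bound 1/2 on \<open>K\<close>.\<close>
  also have "\<dots> \<le> 2 ^ omega q * (16 * (ln (real q) * (1 / 2)))"
    using ln by (intro mult_left_mono) auto
  also have "\<dots> \<le> 2 ^ omega q * (16 * (ln (real q) * K))"
    using totient_prod_ge[of q] q ln by (intro mult_left_mono) (auto simp: K_def)
  finally show "let P = real (totient q) / real q in
      \<bar>1 / real q * (\<Sum>i | square_seq q i < q.
          (real (square_seq q (Suc i)) - real (square_seq q i)) ^ 2)\<bar>
      \<le> 16 * (2 ^ omega q * P * ln (real q) * (\<Prod>p\<in>prime_factors q. 1 + 1 / sqrt (real p)))"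
    by (simp add: M_def K_def Let_def mult_ac)
qed simp

end
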